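(* Let $\Gamma:\mathbb N\to\mathbb R^+$ and $\Theta:\mathbb N\to\mathbb R^+$ be functions such that $\Theta(i)+\Gamma(i)<1$ for each $i$. Suppose $d\ge1$, $C$ is a closed subset of $\mathbb C^d$ such that $\square_{\Theta,\Gamma}(C)$ holds, and $\mathcal F$ is a finite family of continuous functions from $C$ to $\mathbb C$. If $\mu>0$ then there are $a\in\mathbb C^1_\mu$ and $\eta:\mathbb N\to\mathbb R^+$ such that $\square_{\eta,\Gamma}\left(\bigcap_{F\in\mathcal F}F^{-1}([a])\right)$ holds.
   Context: Fix a real number $r$ with $0<r<1$. $\mathbb{C}=2^{\mathbb N}$ denotes the Cantor space with the product topology (not the complex numbers), $\lambda$ the usual product measure on $\mathbb C$ (and the product measure on $\mathbb C^d$), and $\mathbb{Q}=\{f\restriction n: f\in\mathbb C,\ n\in\mathbb N\}$ the tree of finite binary sequences. For $a\in\mathbb Q$, $|a|$ is its length and $[a]=\{x\in\mathbb C: a\subseteq x\}$; for $A\subseteq \mathbb Q$, $[A]=\bigcup_{a\in A}[a]$. Let $\mathbb C^\infty_\epsilon=\{A\subseteq\mathbb Q:\sum_{a\in A}2^{-|a|r}\le\epsilon\}$ and $\mathbb C^1_\epsilon=\{A\subseteq \mathbb Q:\sum_{t\in A}2^{-|t|}\le \epsilon\}$. For $X\subseteq\mathbb C$ let $\lambda^r_\infty(X)=\inf\{\epsilon:\exists A\in\mathbb C^\infty_\epsilon\ X\subseteq[A]\}$ and, for $\delta>0$, $\square_\delta(X)=\inf\{\lambda^r_\infty(X\setminus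 Z): Z\subseteq\mathbb C,\ \lambda(Z)<\delta\}$. For $X\subseteq\mathbb C^m$ and $z\in\mathbb C^k$ ($k\le m$) let $X(z,\cdot)=\{x\in\mathbb C^{m-k}:(z,x)\in X\}$. For $\Theta,\Gamma:\mathbb N\to\mathbb R^+$ and $X\subseteq\mathbb C^d$ the relation $\square_{\Theta,\Gamma}(X)$ is defined by induction on $d$: if $d=1$, $\square_{\Theta,\Gamma}(X)$ iff $\square_{\Theta(0)}(X)\ge\Gamma(0)$; if $d>1$, $\square_{\Theta,\Gamma}(X)$ iff $\square_{\Theta(d-1)}(\{x\in\mathbb C:\square_{\Theta,\Gamma}(X(x,\cdot))\})\ge\Gamma(d-1)$ (here $x\in\mathbb C$ is the first coordinate and $X(x,\cdot)\subseteq\mathbb C^{d-1}$). *)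

theory Defs
  imports "HOL-Analysis.Analysis" "HOL-Probability.Probability"
begin

type_synonym cantor = "nat \<Rightarrow> bool"

text \<open>The completion of the fair-coin product measure.\<close>

definition cantor_measure :: "cantor measure" where
  "cantor_measure = completion (\<Pi>\<^sub>M i\<in>UNIV. measure_pmf (bernoulli_pmf (1/2)))"

definition cyl :: "bool list \<Rightarrow> cantor set" where
  "cyl a = {x. \<forall>i<length a. x i = a ! i}"

definition cyls :: "bool list set \<Rightarrow> cantor set" where
  "cyls A = (\<Union>a\<in>A. cyl a)"

text \<open>The sets of sequences with \<open>\<Sum>a\<in>A. 2 powr (-(|a| * s)) \<le> \<epsilon>\<close>; the families \<open>C_inf\<close> and \<open>C_one\<close> below
  are the cases \<open>s = r\<close> and \<open>s = 1\<close>. Summability must be demanded explicitly, since the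
  real-valued \<open>infsum\<close> of a divergent family is 0.\<close>

definition cover_family :: "real \<Rightarrow> real \<Rightarrow> bool list set set" where
  "cover_family s \<epsilon> =
     {A. (\<lambda>a. 2 powr (- (real (length a) * s))) summable_on A \<and>
         (\<Sum>\<^sub>\<infinity>a\<in>A. 2 powr (- (real (length a) * s))) \<le> \<epsilon>}"

definition C_inf :: "real \<Rightarrow> real \<Rightarrow> bool list set set" where
  "C_inf r \<epsilon> = cover_family r \<epsilon>"

definition C_one :: "real \<Rightarrow> bool list set set" where
  "C_one \<epsilon> = cover_family 1 \<epsilon>"

text \<open>The infimum is over a nonempty set of nonnegative reals: the root alone covers everything
  with sum 1.\<close>

definition lambda_inf :: "real \<Rightarrow> cantor set \<Rightarrow> real" where
  "lambda_inf r X = Inf {\<epsilon>. \<exists>A\<in>C_inf r \<epsilon>. X \<subseteq> cyls A}"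

text \<open>Measurability of \<open>Z\<close> is explicit because \<open>measure\<close> is 0 on non-measurable sets.\<close>

definition box_num :: "real \<Rightarrow> real \<Rightarrow> cantor set \<Rightarrow> real" where
  "box_num r \<delta> X =
     Inf {lambda_inf r (X - Z) | Z. Z \<in> sets cantor_measure \<and> measure cantor_measure Z < \<delta>}"

text \<open>The \<open>d\<close>-th power of the Cantor space is the library's product over the index set \<open>{..<d}\<close>;
  its points are the functions that are \<open>undefined\<close> outside \<open>{..<d}\<close>.\<close>

definition cantor_power :: "nat \<Rightarrow> (nat \<Rightarrow> cantor) topology" where
  "cantor_power d = product_topology (\<lambda>_. euclidean) {..<d}"

text \<open>The section \<open>X(x,\<cdot>)\<close> of a subset \<open>X\<close> of the power \<open>d + 1\<close>, as a subset of the power \<open>d\<close>;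
  \<open>case_nat x y\<close> is the tuple \<open>(x, y 0, \<dots>, y (d - 1))\<close>.\<close>

definition section_at :: "nat \<Rightarrow> (nat \<Rightarrow> cantor) set \<Rightarrow> cantor \<Rightarrow> (nat \<Rightarrow> cantor) set" where
  "section_at d X x = {y \<in> topspace (cantor_power d). case_nat x y \<in> X}"

text \<open>In dimension 1 a point \<open>x\<close> is identified with the 1-tuple \<open>\<lambda>i\<in>{..<1}. x\<close>. The value in
  dimension 0 is a dummy.\<close>

fun box_rel ::
  "real \<Rightarrow> (nat \<Rightarrow> real) \<Rightarrow> (nat \<Rightarrow> real) \<Rightarrow> nat \<Rightarrow> (nat \<Rightarrow> cantor) set \<Rightarrow> bool" where
  "box_rel r \<Theta> \<Gamma> 0 X = False"
| "box_rel r \<Theta> \<Gamma> (Suc 0) X = (box_num r (\<Theta> 0) {x. (\<lambda>i\<in>{..<1}. x) \<in> X} \<ge> \<Gamma> 0)"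
| "box_rel r \<Theta> \<Gamma> (Suc (Suc n)) X =
     (box_num r (\<Theta> (Suc n)) {x. box_rel r \<Theta> \<Gamma> (Suc n) (section_at (Suc n) X x)} \<ge> \<Gamma> (Suc n))"

end

theory Submission
  imports Defs
begin

text \<open>
  Let \<open>a\<close> be a random set of words of a fixed length \<open>m\<close>, each word being chosen independently with
  probability \<open>p\<close>. A point of \<open>C\<close> survives in \<open>\<Inter>F\<in>\<F>. F -` [a]\<close> with probability at least
  \<open>p ^ |\<F>|\<close>. If every point of a one-dimensional set survives with probability at least \<open>q\<close>, then a
  first-moment estimate of the outer measure left uncovered shows that each single cover is defeated
  with probability bounded below. Since \<open>r < 1\<close>, only finitely many covers matter, and as defeating
  a cover is an increasing event in \<open>a\<close>, Harris' inequality shows that all covers are defeated at once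
  with positive probability. Applying this coordinate by coordinate bounds the probability that
  the relation holds for the random set from below, independently of \<open>m\<close>, whereas by Chebyshev's
  inequality the probability that \<open>[a]\<close> has measure above \<open>2 p\<close> tends to \<open>0\<close> as \<open>m\<close> grows.
\<close>

section \<open>Random subsets of a finite set\<close>

text \<open>Expectation of \<open>f\<close> over the random subset that contains each point of
  \<open>S\<close> independently with probability \<open>p\<close>.\<close>

definition subset_mean :: "real \<Rightarrow> 'a set \<Rightarrow> ('a set \<Rightarrow> real) \<Rightarrow> real" where
  "subset_mean p S f = (\<Sum>a\<in>Pow S. (\<Prod>s\<in>S. if s \<in> a then p else 1 - p) * f a)"

definition subset_prob :: "real \<Rightarrow> 'a set \<Rightarrow> ('a set \<Rightarrow> bool) \<Rightarrow> real" where
  "subset_prob p S Q = subset_mean p S (\<lambda>a. of_bool (Q a))"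

lemma subset_mean_empty [simp]: "subset_mean p {} f = f {}"
  by (simp add: subset_mean_def)

text \<open>Conditioning on whether \<open>s\<close> is chosen; the inductions on \<open>S\<close>
  below rest on this recursion.\<close>

lemma subset_mean_insert:
  assumes "finite S" "s \<notin> S"
  shows "subset_mean p (insert s S) f =
    (1 - p) * subset_mean p S f + p * subset_mean p S (\<lambda>a. f (insert s a))"
proof -
  let ?w = "\<lambda>a t. if t \<in> a then p else 1 - p"
  have inj: "inj_on (insert s) (Pow S)"
    using assms(2) by (auto simp: inj_on_def)
  have disj: "Pow S \<inter> insert s ` Pow S = {}"
    using assms(2) by auto
  have 1: "(\<Prod>t\<in>insert s S. ?w a t) = (1 - p) * (\<Prod>t\<in>S. ?w a t)" if "a \<in> Pow S" for a
    using assms that by auto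
  have 2: "(\<Prod>t\<in>insert s S. ?w (insert s a) t) = p * (\<Prod>t\<in>S. ?w a t)" for a
  proof -
    have "(\<Prod>t\<in>S. ?w (insert s a) t) = (\<Prod>t\<in>S. ?w a t)"
      using assms by (intro prod.cong) auto
    then show ?thesis
      using assms by simp
  qed
  have "subset_mean p (insert s S) f =
      (\<Sum>a\<in>Pow S. (\<Prod>t\<in>insert s S. ?w a t) * f a)
      + (\<Sum>a\<in>Pow S. (\<Prod>t\<in>insert s S. ?w (insert s a) t) * f (insert s a))"
    unfolding subset_mean_def Pow_insert
    using assms disj by (subst sum.union_disjoint) (auto simp: sum.reindex[OF inj] simp del: prod.insert)
  also have "\<dots> = (\<Sum>a\<in>Pow S. (1 - p) * ((\<Prod>t\<in>S. ?w a t) * f a))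
      + (\<Sum>a\<in>Pow S. p * ((\<Prod>t\<in>S. ?w a t) * f (insert s a)))"
    by (intro arg_cong2[of _ _ _ _ "(+)"] sum.cong refl) (simp_all only: 1 2 mult.assoc)
  finally show ?thesis
    by (simp add: subset_mean_def sum_distrib_left)
qed

lemma subset_mean_mono:
  assumes "0 \<le> p" "p \<le> 1" "\<And>a. a \<subseteq> S \<Longrightarrow> f a \<le> g a"
  shows "subset_mean p S f \<le> subset_mean p S g"
  unfolding subset_mean_def using assms
  by (intro sum_mono mult_left_mono prod_nonneg) auto

lemma subset_mean_cong:
  assumes "\<And>a. a \<subseteq> S \<Longrightarrow> f a = g a"
  shows "subset_mean p S f = subset_mean p S g"
  unfolding subset_mean_def using assms by (intro sum.cong) auto

lemma subset_mean_add: "subset_mean p S (\<lambda>a. f a + g a) = subset_mean p S f + subset_mean p S g"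
  by (simp add: subset_mean_def algebra_simps sum.distrib)

lemma subset_mean_cmult: "subset_mean p S (\<lambda>a. c * f a) = c * subset_mean p S f"
  by (simp add: subset_mean_def sum_distrib_left algebra_simps)

lemma subset_mean_const:
  assumes "finite S"
  shows "subset_mean p S (\<lambda>_. c) = c"
  using assms by induction (simp_all add: subset_mean_insert algebra_simps)

lemma subset_prob_mono:
  assumes "0 \<le> p" "p \<le> 1" "\<And>a. a \<subseteq> S \<Longrightarrow> P a \<Longrightarrow> Q a"
  shows "subset_prob p S P \<le> subset_prob p S Q"
  unfolding subset_prob_def using assms by (intro subset_mean_mono) auto

lemma subset_prob_nonneg:
  assumes "0 \<le> p" "p \<le> 1"
  shows "0 \<le> subset_prob p S Q"
  unfolding subset_prob_def subset_mean_def
  using assms by (intro sum_nonneg mult_nonneg_nonneg prod_nonneg) auto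

text \<open>Harris' inequality.\<close>

lemma subset_mean_mult_ge:
  fixes f g :: "'a set \<Rightarrow> real"
  assumes "finite S" "0 \<le> p" "p \<le> 1"
    and "\<And>a b. a \<subseteq> b \<Longrightarrow> b \<subseteq> S \<Longrightarrow> f a \<le> f b"
    and "\<And>a b. a \<subseteq> b \<Longrightarrow> b \<subseteq> S \<Longrightarrow> g a \<le> g b"
  shows "subset_mean p S f * subset_mean p S g \<le> subset_mean p S (\<lambda>a. f a * g a)"
  using assms(1,4,5)
proof (induction S arbitrary: f g)
  case empty
  then show ?case by simp
next
  case (insert s S)
  define f0 f1 g0 g1 where "f0 = subset_mean p S f" and "f1 = subset_mean p S (\<lambda>a. f (insert s a))"
    and "g0 = subset_mean p S g" and "g1 = subset_mean p S (\<lambda>a. g (insert s a))"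
  have "f0 * g0 \<le> subset_mean p S (\<lambda>a. f a * g a)"
    unfolding f0_def g0_def
    by (rule insert.IH) (rule insert.prems; blast)+
  moreover have "f1 * g1 \<le> subset_mean p S (\<lambda>a. f (insert s a) * g (insert s a))"
    unfolding f1_def g1_def
    by (rule insert.IH[of "\<lambda>a. f (insert s a)" "\<lambda>a. g (insert s a)"])
      (rule insert.prems; blast)+
  moreover have "f0 \<le> f1"
    unfolding f0_def f1_def
    by (rule subset_mean_mono[OF assms(2,3)], rule insert.prems(1)) auto
  moreover have "g0 \<le> g1"
    unfolding g0_def g1_def
    by (rule subset_mean_mono[OF assms(2,3)], rule insert.prems(2)) auto
  ultimately have le: "(1 - p) * (f0 * g0) + p * (f1 * g1)
      \<le> subset_mean p (insert s S) (\<lambda>a. f a * g a)"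
      and nn: "0 \<le> p * (1 - p) * ((f1 - f0) * (g1 - g0))"
    using assms(2,3) insert.hyps
    by (simp_all add: subset_mean_insert add_mono mult_left_mono)
  \<comment> \<open>The covariance consists of the conditional covariances, nonnegative by
    induction, and the last product, nonnegative because both conditional means increase when
    \<open>s\<close> is chosen.\<close>
  have "((1 - p) * f0 + p * f1) * ((1 - p) * g0 + p * g1)
      = (1 - p) * (f0 * g0) + p * (f1 * g1) - p * (1 - p) * ((f1 - f0) * (g1 - g0))"
    by algebra
  with le nn show ?case
    using insert.hyps by (simp add: subset_mean_insert f0_def f1_def g0_def g1_def)
qed

text \<open>Increasing events are positively correlated by Harris' inequality, so each further event
  costs at most a factor \<open>c\<close>.\<close>

lemma subset_prob_Ball_ge:
  fixes Q :: "'i \<Rightarrow> 'a set \<Rightarrow> bool"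
  assumes "finite I" "finite S" "0 \<le> p" "p \<le> 1"
    and "\<And>i a b. i \<in> I \<Longrightarrow> a \<subseteq> b \<Longrightarrow> b \<subseteq> S \<Longrightarrow> Q i a \<Longrightarrow> Q i b"
    and "0 \<le> c" and "\<And>i. i \<in> I \<Longrightarrow> c \<le> subset_prob p S (Q i)"
  shows "c ^ card I \<le> subset_prob p S (\<lambda>a. \<forall>i\<in>I. Q i a)"
  using assms(1,5,7)
proof (induction I)
  case empty
  then show ?case
    using assms(2) by (simp add: subset_prob_def subset_mean_const)
next
  case (insert i I)
  have "c ^ card (insert i I) \<le> subset_prob p S (Q i) * subset_prob p S (\<lambda>a. \<forall>i\<in>I. Q i a)"
    using insert assms(3,4,6) by (auto intro!: mult_mono subset_prob_nonneg insert.IH)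
  also have "\<dots> \<le> subset_mean p S (\<lambda>a. of_bool (Q i a) * of_bool (\<forall>i\<in>I. Q i a))"
    unfolding subset_prob_def using assms(2-4) insert.prems(1)
    by (intro subset_mean_mult_ge) (simp_all only: of_bool_less_eq_iff, blast+)
  also have "\<dots> = subset_prob p S (\<lambda>a. \<forall>i\<in>insert i I. Q i a)"
    unfolding subset_prob_def by (intro subset_mean_cong) auto
  finally show ?case .
qed

lemma subset_prob_mem:
  assumes "finite S" "t \<in> S"
  shows "subset_prob p S (\<lambda>a. t \<in> a) = p"
proof -
  obtain S' where S: "S = insert t S'" "t \<notin> S'"
    using assms(2) by (meson mk_disjoint_insert)
  then have "subset_mean p S' (\<lambda>a. of_bool (t \<in> a)) = subset_mean p S' (\<lambda>_. 0)"
    by (intro subset_mean_cong) auto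
  then show ?thesis
    using assms(1) S by (simp add: subset_prob_def subset_mean_insert subset_mean_const)
qed

section \<open>Chebyshev's inequality for the size of a random subset\<close>

lemma subset_mean_card:
  assumes "finite S"
  shows "subset_mean p S (\<lambda>a. real (card a)) = p * card S"
  using assms
proof induction
  case (insert s S)
  have "subset_mean p S (\<lambda>a. real (card (insert s a))) = subset_mean p S (\<lambda>a. real (card a) + 1)"
  proof (rule subset_mean_cong)
    fix a assume "a \<subseteq> S"
    then have "finite a" "s \<notin> a"
      using insert.hyps by (auto intro: finite_subset)
    then show "real (card (insert s a)) = real (card a) + 1"
      by simp
  qed
  then show ?case
    using insert by (simp add: subset_mean_insert subset_mean_add subset_mean_const algebra_simps)
qed simp

lemma subset_mean_card_variance:
  assumes "finite S"
  shows "subset_mean p S (\<lambda>a. (real (card a) - p * card S)\<^sup>2) = p * (1 - p) * card S"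
  using assms
proof induction
  case (insert s S)
  let ?X = "\<lambda>a. real (card a) - p * card S"
  have m: "subset_mean p S ?X = 0"
    using subset_mean_add[of p S "\<lambda>a. real (card a)" "\<lambda>_. - (p * card S)"] insert.hyps
    by (simp add: subset_mean_card subset_mean_const)
  \<comment> \<open>Since \<open>?X\<close> has mean 0, a shift by \<open>c\<close> adds
    \<open>c\<^sup>2\<close>. Omitting or choosing \<open>s\<close> shifts the centred size by
    \<open>- p\<close> or \<open>1 - p\<close>; the mean of the two squares is
    \<open>p * (1 - p)\<close>.\<close>
  have sq: "subset_mean p S (\<lambda>a. (?X a + c)\<^sup>2) = p * (1 - p) * card S + c\<^sup>2" for c
  proof -
    have "subset_mean p S (\<lambda>a. (?X a + c)\<^sup>2) = subset_mean p S (\<lambda>a. (?X a)\<^sup>2 + (2 * c * ?X a + c\<^sup>2))"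
      by (intro subset_mean_cong) (simp add: power2_sum mult_ac)
    then show ?thesis
      using insert by (simp only: subset_mean_add subset_mean_cmult subset_mean_const m insert.IH)
  qed
  have "subset_mean p S (\<lambda>a. (real (card a) - p * card (insert s S))\<^sup>2) = p * (1 - p) * card S + (- p)\<^sup>2"
    unfolding sq[symmetric] using insert.hyps
    by (intro subset_mean_cong) (auto simp: algebra_simps)
  moreover have "subset_mean p S (\<lambda>a. (real (card (insert s a)) - p * card (insert s S))\<^sup>2)
      = p * (1 - p) * card S + (1 - p)\<^sup>2"
    unfolding sq[symmetric]
  proof (rule subset_mean_cong)
    fix a assume "a \<subseteq> S"
    then have "finite a" "s \<notin> a"
      using insert.hyps by (auto intro: finite_subset)
    then show "(real (card (insert s a)) - p * card (insert s S))\<^sup>2 = (?X a + (1 - p))\<^sup>2"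
      using insert.hyps by (simp add: algebra_simps)
  qed
  ultimately show ?case
    using insert.hyps by (simp add: subset_mean_insert) (simp add: algebra_simps power2_eq_square)
qed simp

text \<open>On this event the size exceeds its mean \<open>p * card S\<close> by more than that
  mean, while the variance is at most the mean.\<close>

lemma subset_prob_card_gt:
  fixes S :: "'a set"
  assumes "finite S" "S \<noteq> {}" "0 < p" "p \<le> 1"
  shows "subset_prob p S (\<lambda>a. real (card a) > 2 * p * card S) \<le> 1 / (p * card S)"
proof -
  let ?n = "real (card S)"
  have n: "0 < ?n"
    using assms by (simp add: card_gt_0_iff)
  have "(p * ?n)\<^sup>2 * subset_prob p S (\<lambda>a. real (card a) > 2 * p * ?n)
      = subset_mean p S (\<lambda>a. (p * ?n)\<^sup>2 * of_bool (real (card a) > 2 * p * ?n))"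
    by (simp add: subset_prob_def subset_mean_cmult)
  also have "\<dots> \<le> subset_mean p S (\<lambda>a. (real (card a) - p * ?n)\<^sup>2)"
    using assms by (intro subset_mean_mono) (auto intro!: power_mono)
  also have "\<dots> = p * (1 - p) * ?n"
    using assms(1) by (rule subset_mean_card_variance)
  also have "\<dots> \<le> p * ?n"
    using assms n by (intro mult_right_mono) (auto intro: mult_left_le)
  finally have "(p * ?n) * (p * ?n * subset_prob p S (\<lambda>a. real (card a) > 2 * p * ?n)) \<le> (p * ?n) * 1"
    by (simp add: power2_eq_square mult.assoc)
  then have "p * ?n * subset_prob p S (\<lambda>a. real (card a) > 2 * p * ?n) \<le> 1"
    using assms n by (subst (asm) mult_le_cancel_left_pos) auto
  then show ?thesis
    using assms n by (simp add: field_simps)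
qed

section \<open>Covers and the capacity\<close>

abbreviation cover_weight :: "real \<Rightarrow> bool list \<Rightarrow> real" where
  "cover_weight s a \<equiv> 2 powr (- (real (length a) * s))"

lemma prob_space_cantor_measure: "prob_space cantor_measure"
proof -
  have "prob_space (\<Pi>\<^sub>M i\<in>(UNIV :: nat set). measure_pmf (bernoulli_pmf (1/2)))"
    by (intro prob_space_PiM measure_pmf.prob_space_axioms)
  then show ?thesis
    unfolding cantor_measure_def by (intro prob_space.prob_space_completion)
qed

interpretation cantor: prob_space cantor_measure
  by (rule prob_space_cantor_measure)

lemma space_cantor_measure [simp]: "space cantor_measure = UNIV"
  by (simp add: cantor_measure_def space_PiM)

lemma
  shows sets_cyl [measurable, simp]: "cyl a \<in> sets cantor_measure"
    and measure_cyl: "measure cantor_measure (cyl a) = cover_weight 1 a"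
proof -
  let ?M = "\<lambda>i::nat. measure_pmf (bernoulli_pmf (1/2))"
  interpret product_prob_space ?M UNIV
    by unfold_locales
  have eq: "cyl a = prod_emb UNIV ?M {..<length a} (\<Pi>\<^sub>E i\<in>{..<length a}. {a ! i})"
    by (auto simp: cyl_def prod_emb_def PiE_def Pi_def)
  have sets: "cyl a \<in> sets (PiM UNIV ?M)"
    unfolding eq by (intro sets_PiM_I) auto
  then show "cyl a \<in> sets cantor_measure"
    by (simp add: cantor_measure_def)
  have "measure (PiM UNIV ?M) (cyl a) = (\<Prod>i<length a. pmf (bernoulli_pmf (1/2)) (a ! i))"
    unfolding eq by (subst measure_PiM_emb) (auto simp: measure_pmf_single)
  also have "\<dots> = (\<Prod>i<length a. 1/2)"
  proof (rule prod.cong)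
    fix i
    show "pmf (bernoulli_pmf (1/2)) (a ! i) = 1/2"
      by (cases "a ! i") auto
  qed simp
  also have "\<dots> = cover_weight 1 a"
    by (simp add: powr_minus powr_realpow power_one_over field_simps)
  finally show "measure cantor_measure (cyl a) = cover_weight 1 a"
    using sets by (simp add: cantor_measure_def measure_completion)
qed

lemma sets_cyls [measurable, simp]: "cyls A \<in> sets cantor_measure"
  unfolding cyls_def by (intro sets.countable_UN' countableI_type) auto

lemma cyls_mono: "A \<subseteq> B \<Longrightarrow> cyls A \<subseteq> cyls B"
  by (auto simp: cyls_def)

lemma cyls_Un: "cyls (A \<union> B) = cyls A \<union> cyls B"
  by (auto simp: cyls_def)

lemma finite_length_le: "finite {s :: bool list. length s \<le> n}"
  using finite_lists_length_le[of "UNIV :: bool set" n] by simp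

text \<open>A word of length at least \<open>n\<close> has \<open>cover_weight 1 a \<le> 2 powr (-
  (real n * (1 - s))) * cover_weight s a\<close>. With \<open>s = r < 1\<close> the long words of a
  cover thus have small measure.\<close>

lemma measure_cyls_le:
  assumes s: "s \<le> 1" and sum: "cover_weight s summable_on A"
    and long: "\<And>a. a \<in> A \<Longrightarrow> n \<le> length a"
  shows "measure cantor_measure (cyls A) \<le> 2 powr (- (real n * (1 - s))) * (\<Sum>\<^sub>\<infinity>a\<in>A. cover_weight s a)"
    (is "_ \<le> ?c * ?W")
proof -
  \<comment> \<open>Truncation by length gives finite sets; continuity from below recovers
    \<open>A\<close>.\<close>
  define A' where "A' k = {a\<in>A. length a \<le> k}" for k
  have fin: "finite (A' k)" for k
    unfolding A'_def by (rule finite_subset[OF _ finite_length_le[of k]]) auto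
  have le: "measure cantor_measure (cyls (A' k)) \<le> ?c * ?W" for k
  proof -
    have "measure cantor_measure (cyls (A' k)) \<le> (\<Sum>a\<in>A' k. measure cantor_measure (cyl a))"
      unfolding cyls_def using fin by (intro cantor.finite_measure_subadditive_finite) auto
    also have "\<dots> \<le> (\<Sum>a\<in>A' k. ?c * cover_weight s a)"
    proof (rule sum_mono)
      fix a assume "a \<in> A' k"
      then have "real n * (1 - s) \<le> real (length a) * (1 - s)"
        using long s by (intro mult_right_mono) (auto simp: A'_def)
      then show "measure cantor_measure (cyl a) \<le> ?c * cover_weight s a"
        unfolding measure_cyl powr_add[symmetric] by (intro powr_mono) (simp_all add: algebra_simps)
    qed
    also have "\<dots> = ?c * (\<Sum>a\<in>A' k. cover_weight s a)"
      by (simp add: sum_distrib_left)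
    also have "\<dots> \<le> ?c * ?W"
      by (intro mult_left_mono finite_sum_le_infsum[OF sum fin]) (auto simp: A'_def)
    finally show ?thesis .
  qed
  have "incseq (\<lambda>k. cyls (A' k))"
    by (intro monoI cyls_mono) (auto simp: A'_def)
  then have "(\<lambda>k. measure cantor_measure (cyls (A' k))) \<longlonglongrightarrow> measure cantor_measure (\<Union>k. cyls (A' k))"
    by (rule cantor.finite_Lim_measure_incseq[rotated]) auto
  moreover have "(\<Union>k. cyls (A' k)) = cyls A"
    by (auto simp: cyls_def A'_def)
  ultimately show ?thesis
    using le by (intro LIMSEQ_le_const2[where X = "\<lambda>k. measure cantor_measure (cyls (A' k))"]) simp_all
qed

section \<open>Lower bounds for the infima in terms of failing covers\<close>

lemma lambda_inf_set:
  "{\<epsilon>. \<exists>A\<in>C_inf r \<epsilon>. X \<subseteq> cyls A} =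
   {\<epsilon>. \<exists>A. cover_weight r summable_on A \<and> (\<Sum>\<^sub>\<infinity>a\<in>A. cover_weight r a) \<le> \<epsilon> \<and> X \<subseteq> cyls A}"
  by (auto simp: C_inf_def cover_family_def)

lemma lambda_inf_set_nonempty: "{\<epsilon>. \<exists>A\<in>C_inf r \<epsilon>. X \<subseteq> cyls A} \<noteq> {}"
proof -
  have "X \<subseteq> cyls {[]}"
    by (auto simp: cyls_def cyl_def)
  then show ?thesis
    unfolding lambda_inf_set by (metis (mono_tags, lifting) empty_iff finite.intros mem_Collect_eq order_refl summable_on_finite)
qed

lemma lambda_inf_bdd_below: "bdd_below {\<epsilon>. \<exists>A\<in>C_inf r \<epsilon>. X \<subseteq> cyls A}"
proof (rule bdd_belowI[of _ 0])
  fix \<epsilon> assume "\<epsilon> \<in> {\<epsilon>. \<exists>A\<in>C_inf r \<epsilon>. X \<subseteq> cyls A}"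
  then obtain A where "(\<Sum>\<^sub>\<infinity>a\<in>A. cover_weight r a) \<le> \<epsilon>"
    unfolding lambda_inf_set by blast
  moreover have "0 \<le> (\<Sum>\<^sub>\<infinity>a\<in>A. cover_weight r a)"
    by (intro infsum_nonneg) simp
  ultimately show "0 \<le> \<epsilon>"
    by linarith
qed

lemma lambda_inf_ge_iff:
  "\<gamma> \<le> lambda_inf r X \<longleftrightarrow>
    (\<forall>A. cover_weight r summable_on A \<longrightarrow> (\<Sum>\<^sub>\<infinity>a\<in>A. cover_weight r a) < \<gamma> \<longrightarrow> \<not> X \<subseteq> cyls A)"
proof -
  have "\<gamma> \<le> lambda_inf r X \<longleftrightarrow> (\<forall>\<epsilon>\<in>{\<epsilon>. \<exists>A\<in>C_inf r \<epsilon>. X \<subseteq> cyls A}. \<gamma> \<le> \<epsilon>)"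
    unfolding lambda_inf_def by (rule le_cInf_iff[OF lambda_inf_set_nonempty lambda_inf_bdd_below])
  also have "\<dots> \<longleftrightarrow>
      (\<forall>A. cover_weight r summable_on A \<longrightarrow> X \<subseteq> cyls A \<longrightarrow> \<gamma> \<le> (\<Sum>\<^sub>\<infinity>a\<in>A. cover_weight r a))"
    unfolding lambda_inf_set mem_Collect_eq Ball_def by (meson order_refl order_trans)
  finally show ?thesis
    by (meson not_le)
qed

lemma lambda_inf_nonneg: "0 \<le> lambda_inf r X"
  unfolding lambda_inf_ge_iff
proof (intro allI impI)
  fix A :: "bool list set"
  assume "(\<Sum>\<^sub>\<infinity>a\<in>A. cover_weight r a) < 0"
  moreover have "0 \<le> (\<Sum>\<^sub>\<infinity>a\<in>A. cover_weight r a)"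
    by (intro infsum_nonneg) simp
  ultimately show "\<not> X \<subseteq> cyls A"
    by linarith
qed

text \<open>Positivity of \<open>\<delta>\<close> admits the empty \<open>Z\<close>, so the infimum
  is over a nonempty set. With \<open>Z\<close> and \<open>cyls A\<close> on one side of the
  inclusion, pieces of a cover can later be moved into the exceptional set.\<close>

lemma box_num_ge_iff:
  assumes "0 < \<delta>"
  shows "\<gamma> \<le> box_num r \<delta> X \<longleftrightarrow>
    (\<forall>Z A. Z \<in> sets cantor_measure \<longrightarrow> measure cantor_measure Z < \<delta> \<longrightarrow>
      cover_weight r summable_on A \<longrightarrow> (\<Sum>\<^sub>\<infinity>a\<in>A. cover_weight r a) < \<gamma> \<longrightarrow> \<not> X \<subseteq> Z \<union> cyls A)"
proof -
  let ?S = "{lambda_inf r (X - Z) | Z. Z \<in> sets cantor_measure \<and> measure cantor_measure Z < \<delta>}"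
  have "?S \<noteq> {}"
    using assms by (auto intro!: exI[of _ "{}"])
  moreover have "bdd_below ?S"
    using lambda_inf_nonneg by (auto intro!: bdd_belowI[of _ 0])
  ultimately have "\<gamma> \<le> box_num r \<delta> X \<longleftrightarrow> (\<forall>x\<in>?S. \<gamma> \<le> x)"
    unfolding box_num_def by (rule le_cInf_iff)
  also have "\<dots> \<longleftrightarrow> (\<forall>Z. Z \<in> sets cantor_measure \<longrightarrow> measure cantor_measure Z < \<delta> \<longrightarrow>
      \<gamma> \<le> lambda_inf r (X - Z))"
    by blast
  finally show ?thesis
    unfolding lambda_inf_ge_iff Diff_subset_conv by blast
qed

lemma box_num_mono:
  assumes "0 < \<delta>" "X \<subseteq> Y" "\<gamma> \<le> box_num r \<delta> X"
  shows "\<gamma> \<le> box_num r \<delta> Y"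
proof -
  have "\<not> Y \<subseteq> Z \<union> cyls A"
    if "Z \<in> sets cantor_measure" "measure cantor_measure Z < \<delta>" "cover_weight r summable_on A"
      "(\<Sum>\<^sub>\<infinity>a\<in>A. cover_weight r a) < \<gamma>" for Z A
  proof -
    have "\<not> X \<subseteq> Z \<union> cyls A"
      using assms(3)[unfolded box_num_ge_iff[OF assms(1)]] that by simp
    then show ?thesis
      using assms(2) by (meson order_trans)
  qed
  then show ?thesis
    unfolding box_num_ge_iff[OF assms(1)] by simp
qed

section \<open>Random subsets with large capacity\<close>

text \<open>First-moment argument. Cover \<open>Y a\<close> outside \<open>W\<close> by a measurable
  \<open>Z a\<close>, small whenever the event fails. Points of \<open>B\<close> outside
  \<open>W\<close> lie in \<open>Z a\<close> with probability at least \<open>q\<close>, so by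
  \<open>large\<close> the mean measure of \<open>Z a\<close> is at least
  \<open>q * \<theta>\<close>; as measures are at most 1, the event cannot be too rare.\<close>

lemma subset_prob_outer_measure_ge:
  fixes Y :: "'a set \<Rightarrow> cantor set"
  assumes p: "0 \<le> p" "p \<le> 1" and "0 < q"
    and prob: "\<And>x. x \<in> B \<Longrightarrow> q \<le> subset_prob p S (\<lambda>a. x \<in> Y a)"
    and large: "\<And>Z. Z \<in> sets cantor_measure \<Longrightarrow> B \<subseteq> Z \<union> W \<Longrightarrow> \<theta> \<le> measure cantor_measure Z"
    and "finite S" and "0 < \<theta>"
  shows "q * \<theta> / 2 \<le> subset_prob p S (\<lambda>a. \<forall>Z\<in>sets cantor_measure.
    Y a \<subseteq> Z \<union> W \<longrightarrow> q * \<theta> / 2 \<le> measure cantor_measure Z)"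
proof -
  define Q where "Q a \<longleftrightarrow> (\<forall>Z\<in>sets cantor_measure. Y a \<subseteq> Z \<union> W \<longrightarrow> q * \<theta> / 2 \<le> measure cantor_measure Z)" for a
  \<comment> \<open>One bound for both cases: the whole space if the event holds, otherwise a set
    witnessing its failure.\<close>
  have "\<exists>Z\<in>sets cantor_measure. Y a \<subseteq> Z \<union> W \<and> measure cantor_measure Z \<le> of_bool (Q a) + q * \<theta> / 2" for a
  proof (cases "Q a")
    case True
    have "0 < q * \<theta>"
      using assms by simp
    then show ?thesis
      using True sets.top[of cantor_measure] cantor.prob_space by (intro bexI[of _ UNIV]) simp_all
  next
    case False
    then show ?thesis
      unfolding Q_def by (auto simp: not_le intro: less_imp_le)
  qed
  then obtain Z where Z [measurable]: "\<And>a. Z a \<in> sets cantor_measure"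
    and cover: "\<And>a. Y a \<subseteq> Z a \<union> W"
    and small: "\<And>a. measure cantor_measure (Z a) \<le> of_bool (Q a) + q * \<theta> / 2"
    by metis
  define h where "h x = subset_mean p S (\<lambda>a. indicator (Z a) x)" for x
  have int_Z: "integrable cantor_measure (indicator (Z a) :: _ \<Rightarrow> real)" for a
    by (intro integrable_real_indicator Z) (simp add: less_top[symmetric])
  then have int: "integrable cantor_measure h"
    unfolding h_def subset_mean_def by (intro Bochner_Integration.integrable_sum integrable_mult_right)
  then have [measurable]: "h \<in> borel_measurable cantor_measure"
    by (rule borel_measurable_integrable)
  have "integral\<^sup>L cantor_measure h = subset_mean p S (\<lambda>a. measure cantor_measure (Z a))"
    unfolding h_def subset_mean_def
    using int_Z by (subst Bochner_Integration.integral_sum) auto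
  also have "\<dots> \<le> subset_mean p S (\<lambda>a. of_bool (Q a) + q * \<theta> / 2)"
    using p small by (intro subset_mean_mono) auto
  also have "\<dots> = subset_prob p S Q + q * \<theta> / 2"
    using assms by (simp only: subset_mean_add subset_mean_const subset_prob_def)
  finally have mean: "integral\<^sup>L cantor_measure h \<le> subset_prob p S Q + q * \<theta> / 2" .
  define T where "T = {x. q \<le> h x}"
  have "{x\<in>space cantor_measure. q \<le> h x} \<in> sets cantor_measure"
    by measurable
  then have T: "T \<in> sets cantor_measure"
    by (simp add: T_def)
  have "B \<subseteq> T \<union> W"
  proof
    fix x assume "x \<in> B"
    show "x \<in> T \<union> W"
    proof (cases "x \<in> W")
      case False
      have "q \<le> subset_prob p S (\<lambda>a. x \<in> Y a)"
        using \<open>x \<in> B\<close> by (rule prob)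
      also have "\<dots> \<le> h x"
        unfolding h_def subset_prob_def
      proof (rule subset_mean_mono[OF p])
        fix a
        show "of_bool (x \<in> Y a) \<le> (indicator (Z a) x :: real)"
          using cover[of a] False by (auto simp: indicator_def)
      qed
      finally show ?thesis
        by (simp add: T_def)
    qed simp
  qed
  \<comment> \<open>\<open>large\<close> applies to \<open>T\<close>; Markov's inequality then
    bounds the integral of \<open>h\<close> below by \<open>q * \<theta>\<close>.\<close>
  then have "q * \<theta> \<le> q * measure cantor_measure T"
    using large[OF T] \<open>0 < q\<close> by simp
  also have "\<dots> \<le> integral\<^sup>L cantor_measure h"
  proof -
    have "q * measure cantor_measure T = integral\<^sup>L cantor_measure (\<lambda>x. q * indicator T x)"
      using T by simp
    also have "\<dots> \<le> integral\<^sup>L cantor_measure h"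
    proof (rule integral_mono[OF _ int])
      show "integrable cantor_measure (\<lambda>x. q * indicator T x)"
        using T by (intro integrable_mult_right integrable_real_indicator) (simp_all add: less_top[symmetric])
      fix x
      have "0 \<le> h x"
        unfolding h_def using subset_mean_mono[OF p, of S "\<lambda>_. 0" "\<lambda>a. indicator (Z a) x"]
        by (simp add: subset_mean_def)
      then show "q * indicator T x \<le> h x"
        by (simp add: T_def indicator_def)
    qed
    finally show ?thesis .
  qed
  finally show ?thesis
    using mean unfolding Q_def by simp
qed

text \<open>The bounds \<open>\<eta>\<close> and \<open>q'\<close> do not depend on \<open>p\<close> and \<open>S\<close>. Words longer than \<open>n\<close> are absorbed
  into the exceptional set, so only the finitely many covers by words of length at most \<open>n\<close> have to
  be defeated, and the corresponding events are increasing.\<close>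

lemma box_num_random:
  assumes "r < 1" "0 < \<theta>" "0 < \<gamma>" "0 < q"
  shows "\<exists>\<eta>>0. \<exists>q'>0. \<forall>p (S :: 'a set) B Y. finite S \<longrightarrow> 0 \<le> p \<longrightarrow> p \<le> 1 \<longrightarrow>
    (\<forall>a b. a \<subseteq> b \<longrightarrow> b \<subseteq> S \<longrightarrow> Y a \<subseteq> Y b) \<longrightarrow>
    (\<forall>x\<in>B. q \<le> subset_prob p S (\<lambda>a. x \<in> Y a)) \<longrightarrow> \<gamma> \<le> box_num r \<theta> B \<longrightarrow>
    q' \<le> subset_prob p S (\<lambda>a. \<gamma> \<le> box_num r \<eta> (Y a))"
proof -
  \<comment> \<open>Each cover will be defeated at level \<open>q * \<theta> / 2\<close>, which is
    \<open>2 * \<eta>\<close>: one \<open>\<eta>\<close> pays for the exceptional set, the other for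
    the long words.\<close>
  define \<eta> where "\<eta> = q * \<theta> / 4"
  have "0 < \<eta>"
    using assms by (simp add: \<eta>_def)
  \<comment> \<open>As \<open>r < 1\<close>, some \<open>n\<close> keeps the measure of the words of
    length at least \<open>n\<close> below \<open>\<eta>\<close> in every cover of weight below
    \<open>\<gamma>\<close>.\<close>
  have "(2::real) powr (- (1 - r)) < 2 powr 0"
    using assms by (intro powr_less_mono) auto
  then obtain n where "(2 powr (- (1 - r))) ^ n < \<eta> / \<gamma>"
    using real_arch_pow_inv[of "\<eta> / \<gamma>" "2 powr (- (1 - r))"] \<open>0 < \<eta>\<close> \<open>0 < \<gamma>\<close> by auto
  then have n: "2 powr (- (real n * (1 - r))) * \<gamma> < \<eta>"
    using \<open>0 < \<gamma>\<close> by (simp add: powr_power field_simps)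
  define \<A> where "\<A> = {A. A \<subseteq> {s. length s \<le> n} \<and> (\<Sum>\<^sub>\<infinity>a\<in>A. cover_weight r a) < \<gamma>}"
  have fin: "finite \<A>"
    unfolding \<A>_def by (rule finite_subset[of _ "Pow {s. length s \<le> n}"]) (auto simp: finite_length_le)
  have sumA: "cover_weight r summable_on A" if "A \<in> \<A>" for A
    using that finite_subset[OF _ finite_length_le[of n]] unfolding \<A>_def by (intro summable_on_finite) blast
  \<comment> \<open>The cover \<open>A\<close> is defeated, even with exceptional sets of measure
    below \<open>2 * \<eta>\<close>.\<close>
  define Q where "Q Y A a \<longleftrightarrow> (\<forall>Z\<in>sets cantor_measure. Y a \<subseteq> Z \<union> cyls A \<longrightarrow> 2 * \<eta> \<le> measure cantor_measure Z)"
    for Y :: "'a set \<Rightarrow> cantor set" and A a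
  have large: "\<gamma> \<le> box_num r \<eta> (Y a)" if Q: "\<forall>A\<in>\<A>. Q Y A a" for Y :: "'a set \<Rightarrow> cantor set" and a
    unfolding box_num_ge_iff[OF \<open>0 < \<eta>\<close>]
  proof (intro allI impI notI)
    fix Z A
    assume Z: "Z \<in> sets cantor_measure" "measure cantor_measure Z < \<eta>"
      and A: "cover_weight r summable_on A" "(\<Sum>\<^sub>\<infinity>a\<in>A. cover_weight r a) < \<gamma>"
      and sub: "Y a \<subseteq> Z \<union> cyls A"
    have less: "(\<Sum>\<^sub>\<infinity>a\<in>A'. cover_weight r a) < \<gamma>" and summ: "cover_weight r summable_on A'"
      if "A' \<subseteq> A" for A'
    proof -
      show 1: "cover_weight r summable_on A'"
        using A(1) that by (rule summable_on_subset_banach)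
      have "(\<Sum>\<^sub>\<infinity>a\<in>A'. cover_weight r a) \<le> (\<Sum>\<^sub>\<infinity>a\<in>A. cover_weight r a)"
        using 1 A(1) that by (rule infsum_mono2) simp
      then show "(\<Sum>\<^sub>\<infinity>a\<in>A'. cover_weight r a) < \<gamma>"
        using A(2) by simp
    qed
    \<comment> \<open>The short part lies in \<open>\<A>\<close>, the long part joins
      \<open>Z\<close>. Words of length exactly \<open>n\<close> fall in both, which is
      harmless.\<close>
    define A0 A1 where "A0 = {s\<in>A. length s \<le> n}" and "A1 = {s\<in>A. n \<le> length s}"
    have "A = A0 \<union> A1"
      by (auto simp: A0_def A1_def)
    then have "Y a \<subseteq> (Z \<union> cyls A1) \<union> cyls A0"
      using sub by (auto simp: cyls_Un)
    moreover have "A0 \<in> \<A>"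
      using less[of A0] by (auto simp: \<A>_def A0_def)
    ultimately have "2 * \<eta> \<le> measure cantor_measure (Z \<union> cyls A1)"
      using Q Z(1) unfolding Q_def by (meson sets.Un sets_cyls)
    also have "\<dots> \<le> measure cantor_measure Z + measure cantor_measure (cyls A1)"
      using Z(1) by (intro measure_Un_le) auto
    also have "measure cantor_measure (cyls A1)
        \<le> 2 powr (- (real n * (1 - r))) * (\<Sum>\<^sub>\<infinity>a\<in>A1. cover_weight r a)"
      using \<open>r < 1\<close> by (intro measure_cyls_le summ) (auto simp: A1_def)
    also have "\<dots> \<le> 2 powr (- (real n * (1 - r))) * \<gamma>"
      using less[of A1] by (intro mult_left_mono) (auto simp: A1_def)
    finally show False
      using n Z(2) by simp
  qed
  have "(2 * \<eta>) ^ card \<A> \<le> subset_prob p S (\<lambda>a. \<gamma> \<le> box_num r \<eta> (Y a))"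
    if "finite S" "0 \<le> p" "p \<le> 1"
      and mono: "\<forall>a b. a \<subseteq> b \<longrightarrow> b \<subseteq> S \<longrightarrow> Y a \<subseteq> Y b"
      and prob: "\<forall>x\<in>B. q \<le> subset_prob p S (\<lambda>a. x \<in> Y a)"
      and box: "\<gamma> \<le> box_num r \<theta> B"
    for p and S :: "'a set" and B Y
  proof -
    have "(2 * \<eta>) ^ card \<A> \<le> subset_prob p S (\<lambda>a. \<forall>A\<in>\<A>. Q Y A a)"
    proof (rule subset_prob_Ball_ge[OF fin that(1-3)])
      show "Q Y A b" if "a \<subseteq> b" "b \<subseteq> S" "Q Y A a" for A a b
        using that mono unfolding Q_def by (meson order_trans)
      show "0 \<le> 2 * \<eta>"
        using \<open>0 < \<eta>\<close> by simp
      fix A assume A: "A \<in> \<A>"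
      have "q * \<theta> / 2 \<le> subset_prob p S (\<lambda>a. \<forall>Z\<in>sets cantor_measure.
          Y a \<subseteq> Z \<union> cyls A \<longrightarrow> q * \<theta> / 2 \<le> measure cantor_measure Z)"
      proof (rule subset_prob_outer_measure_ge)
        \<comment> \<open>Since \<open>A\<close> weighs less than \<open>\<gamma>\<close>, a smaller
          \<open>Z\<close> would contradict \<open>box\<close>.\<close>
        show "\<theta> \<le> measure cantor_measure Z" if "Z \<in> sets cantor_measure" "B \<subseteq> Z \<union> cyls A" for Z
        proof (rule ccontr)
          assume "\<not> \<theta> \<le> measure cantor_measure Z"
          moreover have "(\<Sum>\<^sub>\<infinity>a\<in>A. cover_weight r a) < \<gamma>"
            using A by (simp add: \<A>_def)
          ultimately show False
            using box that sumA[OF A] unfolding box_num_ge_iff[OF \<open>0 < \<theta>\<close>] by (simp add: not_le)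
        qed
      qed (use that assms prob in auto)
      moreover have "q * \<theta> / 2 = 2 * \<eta>"
        by (simp add: \<eta>_def)
      ultimately show "2 * \<eta> \<le> subset_prob p S (Q Y A)"
        by (simp add: Q_def[abs_def])
    qed
    also have "\<dots> \<le> subset_prob p S (\<lambda>a. \<gamma> \<le> box_num r \<eta> (Y a))"
      by (rule subset_prob_mono[OF that(2,3)]) (rule large)
    finally show ?thesis .
  qed
  then show ?thesis
    using \<open>0 < \<eta>\<close> by (intro exI[of _ \<eta>] conjI exI[of _ "(2 * \<eta>) ^ card \<A>"]) simp_all
qed

section \<open>Passing to several coordinates\<close>

lemma section_at_mono: "X \<subseteq> Y \<Longrightarrow> section_at n X x \<subseteq> section_at n Y x"
  by (auto simp: section_at_def)

text \<open>Inclusions pass to sections, and \<open>box_num_mono\<close> lifts them by one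
  coordinate. This makes the set of first coordinates with a large random section increasing in
  \<open>a\<close>.\<close>

lemma box_rel_mono:
  assumes "\<And>i. 0 < \<Theta> i" "X \<subseteq> Y" "box_rel r \<Theta> \<Gamma> d X"
  shows "box_rel r \<Theta> \<Gamma> d Y"
  using assms(2,3)
proof (induction d arbitrary: X Y)
  case (Suc n)
  show ?case
  proof (cases n)
    case 0
    with Suc.prems show ?thesis
      by (auto intro: box_num_mono[OF assms(1), rotated])
  next
    case (Suc k)
    have "{x. box_rel r \<Theta> \<Gamma> (Suc k) (section_at (Suc k) X x)}
        \<subseteq> {x. box_rel r \<Theta> \<Gamma> (Suc k) (section_at (Suc k) Y x)}"
      using Suc.IH Suc section_at_mono[OF Suc.prems(1)] by blast
    then show ?thesis
      using Suc.prems(2) Suc by (auto intro: box_num_mono[OF assms(1), rotated])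
  qed
qed simp

lemma box_rel_cong:
  assumes "\<And>i. i < d \<Longrightarrow> \<Theta> i = \<Theta>' i"
  shows "box_rel r \<Theta> \<Gamma> d X = box_rel r \<Theta>' \<Gamma> d X"
  using assms by (induction r \<Theta> \<Gamma> d X rule: box_rel.induct) auto

text \<open>Where the section of \<open>X\<close> at \<open>x\<close> is large, the induction
  hypothesis makes the random section large with probability at least \<open>q1\<close>;
  \<open>box_num_random\<close> then handles the set of these \<open>x\<close> with
  \<open>q1\<close> for \<open>q\<close>. The constants precede \<open>S\<close>, \<open>X\<close>
  and \<open>Y\<close>, so the same ones serve all sections.\<close>

lemma box_rel_random:
  assumes "r < 1" "\<And>i. 0 < \<Theta> i" "\<And>i. 0 < \<Gamma> i" "0 < q"
  shows "\<exists>\<eta>. (\<forall>i. 0 < \<eta> i) \<and> (\<exists>q'>0. \<forall>p (S :: 'a set) X Y. finite S \<longrightarrow> 0 \<le> p \<longrightarrow> p \<le> 1 \<longrightarrow>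
    (\<forall>a b. a \<subseteq> b \<longrightarrow> b \<subseteq> S \<longrightarrow> Y a \<subseteq> Y b) \<longrightarrow>
    (\<forall>y\<in>X. q \<le> subset_prob p S (\<lambda>a. y \<in> Y a)) \<longrightarrow> box_rel r \<Theta> \<Gamma> d X \<longrightarrow>
    q' \<le> subset_prob p S (\<lambda>a. box_rel r \<eta> \<Gamma> d (Y a)))"
proof (induction d)
  case 0
  show ?case
    \<comment> \<open>In dimension 0 the relation is false, so any positive constants do.\<close>
    by (auto intro!: exI[of _ "\<lambda>_. 1"] exI[of _ 1])
next
  case (Suc n)
  show ?case
  proof (cases n)
    case 0
    obtain \<eta> q' where pos: "0 < \<eta>" "0 < q'" and
      *: "\<forall>p (S :: 'a set) B Y. finite S \<longrightarrow> 0 \<le> p \<longrightarrow> p \<le> 1 \<longrightarrow>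
        (\<forall>a b. a \<subseteq> b \<longrightarrow> b \<subseteq> S \<longrightarrow> Y a \<subseteq> Y b) \<longrightarrow>
        (\<forall>x\<in>B. q \<le> subset_prob p S (\<lambda>a. x \<in> Y a)) \<longrightarrow> \<Gamma> 0 \<le> box_num r (\<Theta> 0) B \<longrightarrow>
        q' \<le> subset_prob p S (\<lambda>a. \<Gamma> 0 \<le> box_num r \<eta> (Y a))"
      using box_num_random[OF assms(1) assms(2)[of 0] assms(3)[of 0] assms(4), where 'a = 'a]
      by (elim exE conjE) (rule that)
    have "q' \<le> subset_prob p S (\<lambda>a. box_rel r (\<lambda>_. \<eta>) \<Gamma> (Suc n) (Y a))"
      if "finite S" "0 \<le> p" "p \<le> 1" "\<forall>a b. a \<subseteq> b \<longrightarrow> b \<subseteq> S \<longrightarrow> Y a \<subseteq> Y b"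
        "\<forall>y\<in>X. q \<le> subset_prob p S (\<lambda>a. y \<in> Y a)" "box_rel r \<Theta> \<Gamma> (Suc n) X"
      for p and S :: "'a set" and X Y
    proof -
      have "q' \<le> subset_prob p S (\<lambda>a. \<Gamma> 0 \<le> box_num r \<eta> {x. (\<lambda>i\<in>{..<1}. x) \<in> Y a})"
      proof (rule *[rule_format, OF that(1-3)])
        show "\<Gamma> 0 \<le> box_num r (\<Theta> 0) {x. (\<lambda>i\<in>{..<1}. x) \<in> X}"
          using that(6) by (simp add: 0)
        show "{x. (\<lambda>i\<in>{..<1}. x) \<in> Y a} \<subseteq> {x. (\<lambda>i\<in>{..<1}. x) \<in> Y b}" if "a \<subseteq> b" "b \<subseteq> S" for a b
          using that \<open>\<forall>a b. a \<subseteq> b \<longrightarrow> b \<subseteq> S \<longrightarrow> Y a \<subseteq> Y b\<close> by blast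
      qed (use that(5) in simp)
      then show ?thesis
        by (simp add: 0)
    qed
    with pos show ?thesis
      by (intro exI[of _ "\<lambda>_. \<eta>"] conjI exI[of _ q']) simp_all
  next
    case n: (Suc k)
    obtain \<eta>1 q1 where pos1: "\<forall>i. 0 < \<eta>1 i" "0 < q1" and
      1: "\<forall>p (S :: 'a set) X Y. finite S \<longrightarrow> 0 \<le> p \<longrightarrow> p \<le> 1 \<longrightarrow>
        (\<forall>a b. a \<subseteq> b \<longrightarrow> b \<subseteq> S \<longrightarrow> Y a \<subseteq> Y b) \<longrightarrow>
        (\<forall>y\<in>X. q \<le> subset_prob p S (\<lambda>a. y \<in> Y a)) \<longrightarrow> box_rel r \<Theta> \<Gamma> n X \<longrightarrow>
        q1 \<le> subset_prob p S (\<lambda>a. box_rel r \<eta>1 \<Gamma> n (Y a))"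
      using Suc.IH by (elim exE conjE) (rule that)
    obtain \<eta>2 q' where pos2: "0 < \<eta>2" "0 < q'" and
      2: "\<forall>p (S :: 'a set) B Y. finite S \<longrightarrow> 0 \<le> p \<longrightarrow> p \<le> 1 \<longrightarrow>
        (\<forall>a b. a \<subseteq> b \<longrightarrow> b \<subseteq> S \<longrightarrow> Y a \<subseteq> Y b) \<longrightarrow>
        (\<forall>x\<in>B. q1 \<le> subset_prob p S (\<lambda>a. x \<in> Y a)) \<longrightarrow> \<Gamma> n \<le> box_num r (\<Theta> n) B \<longrightarrow>
        q' \<le> subset_prob p S (\<lambda>a. \<Gamma> n \<le> box_num r \<eta>2 (Y a))"
      using box_num_random[OF assms(1) assms(2)[of n] assms(3)[of n] pos1(2), where 'a = 'a]
      by (elim exE conjE) (rule that)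
    \<comment> \<open>Dimension \<open>n\<close> reads only indices below \<open>n\<close>, so index
      \<open>n\<close> is free for the new bound.\<close>
    define \<eta> where "\<eta> = \<eta>1(n := \<eta>2)"
    have cong: "box_rel r \<eta> \<Gamma> n X = box_rel r \<eta>1 \<Gamma> n X" for X
      by (rule box_rel_cong) (simp add: \<eta>_def)
    have rel_Suc: "box_rel r \<Theta> \<Gamma> (Suc n) X \<longleftrightarrow>
        \<Gamma> n \<le> box_num r (\<Theta> n) {x. box_rel r \<Theta> \<Gamma> n (section_at n X x)}" for X \<Theta>
      by (simp add: n)
    have "q' \<le> subset_prob p S (\<lambda>a. box_rel r \<eta> \<Gamma> (Suc n) (Y a))"
      if S: "finite S" "0 \<le> p" "p \<le> 1" and mono: "\<forall>a b. a \<subseteq> b \<longrightarrow> b \<subseteq> S \<longrightarrow> Y a \<subseteq> Y b"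
        and prob: "\<forall>y\<in>X. q \<le> subset_prob p S (\<lambda>a. y \<in> Y a)" and rel: "box_rel r \<Theta> \<Gamma> (Suc n) X"
      for p and S :: "'a set" and X Y
    proof -
      have "q' \<le> subset_prob p S (\<lambda>a. \<Gamma> n \<le> box_num r \<eta>2 {x. box_rel r \<eta>1 \<Gamma> n (section_at n (Y a) x)})"
      proof (rule 2[rule_format, OF S])
        show "\<Gamma> n \<le> box_num r (\<Theta> n) {x. box_rel r \<Theta> \<Gamma> n (section_at n X x)}"
          using rel by (simp only: rel_Suc)
        show "{x. box_rel r \<eta>1 \<Gamma> n (section_at n (Y a) x)}
            \<subseteq> {x. box_rel r \<eta>1 \<Gamma> n (section_at n (Y b) x)}" if "a \<subseteq> b" "b \<subseteq> S" for a b
        proof -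
          have "Y a \<subseteq> Y b"
            using mono that by simp
          then show ?thesis
            using box_rel_mono[OF pos1(1)[rule_format] section_at_mono] by (intro Collect_mono impI)
        qed
        show "q1 \<le> subset_prob p S (\<lambda>a. x \<in> {x. box_rel r \<eta>1 \<Gamma> n (section_at n (Y a) x)})"
          if x: "x \<in> {x. box_rel r \<Theta> \<Gamma> n (section_at n X x)}" for x
        proof -
          have "q1 \<le> subset_prob p S (\<lambda>a. box_rel r \<eta>1 \<Gamma> n (section_at n (Y a) x))"
          proof (rule 1[rule_format, OF S])
            show "section_at n (Y a) x \<subseteq> section_at n (Y b) x" if "a \<subseteq> b" "b \<subseteq> S" for a b
              using mono that by (intro section_at_mono) simp
            show "q \<le> subset_prob p S (\<lambda>a. y \<in> section_at n (Y a) x)" if "y \<in> section_at n X x" for y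
              using prob that by (simp add: section_at_def)
            show "box_rel r \<Theta> \<Gamma> n (section_at n X x)"
              using x by simp
          qed
          then show "q1 \<le> subset_prob p S (\<lambda>a. x \<in> {x. box_rel r \<eta>1 \<Gamma> n (section_at n (Y a) x)})"
            by simp
        qed
      qed
      then show ?thesis
        by (simp only: rel_Suc cong) (simp add: \<eta>_def)
    qed
    moreover have "\<forall>i. 0 < \<eta> i"
      using pos1 pos2 by (simp add: \<eta>_def)
    ultimately show ?thesis
      using pos2(2) by (intro exI[of _ \<eta>] conjI exI[of _ q']) simp_all
  qed
qed

section \<open>Random sets of words of one length\<close>

theorem theorem3p10:
  fixes r \<mu> :: real and \<Gamma> \<Theta> :: "nat \<Rightarrow> real" and d :: nat
    and C :: "(nat \<Rightarrow> cantor) set" and \<F> :: "((nat \<Rightarrow> cantor) \<Rightarrow> cantor) set"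
  assumes "0 < r" and "r < 1"
    and "\<And>i. \<Gamma> i > 0" and "\<And>i. \<Theta> i > 0"
    and "\<And>i. \<Theta> i + \<Gamma> i < 1"
    and "d \<ge> 1"
    and "closedin (cantor_power d) C"
    and "box_rel r \<Theta> \<Gamma> d C"
    and "finite \<F>"
    and "\<And>F. F \<in> \<F> \<Longrightarrow> continuous_map (subtopology (cantor_power d) C) euclidean F"
    and "\<mu> > 0"
  shows "\<exists>a\<in>C_one \<mu>. \<exists>\<eta>::nat \<Rightarrow> real. (\<forall>i. \<eta> i > 0) \<and>
           box_rel r \<eta> \<Gamma> d (C \<inter> (\<Inter>F\<in>\<F>. F -` cyls a))"
proof -
  \<comment> \<open>The chosen set will have weight at most \<open>2 * p\<close>, hence
    \<open>\<mu> / 2\<close>; the cap \<open>1 / 2\<close> keeps \<open>p\<close> a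
    probability.\<close>
  define p where "p = min (\<mu> / 2) (1 / 2)"
  have p: "0 < p" "p \<le> 1" "2 * p \<le> \<mu>"
    using \<open>\<mu> > 0\<close> by (auto simp: p_def)
  define Y where "Y a = C \<inter> (\<Inter>F\<in>\<F>. F -` cyls a)" for a
  obtain \<eta> q' where "\<forall>i. 0 < \<eta> i" "0 < q'" and
    *: "\<forall>p' (S :: bool list set) X Y. finite S \<longrightarrow> 0 \<le> p' \<longrightarrow> p' \<le> 1 \<longrightarrow>
      (\<forall>a b. a \<subseteq> b \<longrightarrow> b \<subseteq> S \<longrightarrow> Y a \<subseteq> Y b) \<longrightarrow>
      (\<forall>y\<in>X. p ^ card \<F> \<le> subset_prob p' S (\<lambda>a. y \<in> Y a)) \<longrightarrow> box_rel r \<Theta> \<Gamma> d X \<longrightarrow>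
      q' \<le> subset_prob p' S (\<lambda>a. box_rel r \<eta> \<Gamma> d (Y a))"
    using box_rel_random[where \<Theta> = \<Theta> and \<Gamma> = \<Gamma> and d = d and 'a = "bool list",
        OF assms(2,4,3) zero_less_power[OF p(1), of "card \<F>"]]
    by (elim exE conjE) (rule that)
  \<comment> \<open>\<open>q'\<close> is fixed before the word length, so \<open>m\<close> can make
    the Chebyshev bound \<open>1 / (p * 2 ^ m)\<close> smaller than \<open>q'\<close>.\<close>
  obtain m where m: "(1 / 2 :: real) ^ m < p * q'"
    using real_arch_pow_inv[of "p * q'" "1 / 2"] p \<open>0 < q'\<close> by auto
  define S where "S = {s :: bool list. length s = m}"
  have card: "card S = 2 ^ m" and fin: "finite S"
    using card_lists_length_eq[of "UNIV :: bool set" m] finite_lists_length_eq[of "UNIV :: bool set" m]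
    by (simp_all add: S_def)
  have "q' \<le> subset_prob p S (\<lambda>a. box_rel r \<eta> \<Gamma> d (Y a))"
  proof (rule *[rule_format, OF fin])
    show "Y a \<subseteq> Y b" if "a \<subseteq> b" for a b
      using cyls_mono[OF that] unfolding Y_def by blast
    show "p ^ card \<F> \<le> subset_prob p S (\<lambda>a. y \<in> Y a)" if "y \<in> C" for y
    proof -
      \<comment> \<open>The point \<open>y\<close> survives once the prefix of length
        \<open>m\<close> of each \<open>F y\<close> is chosen. Prefixes may coincide for different
        \<open>F\<close>, so positive correlation replaces independence.\<close>
      have "p ^ card \<F> \<le> subset_prob p S (\<lambda>a. \<forall>F\<in>\<F>. map (F y) [0..<m] \<in> a)"
        using p fin \<open>finite \<F>\<close>
        by (intro subset_prob_Ball_ge) (auto simp: S_def subset_prob_mem)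
      also have "\<dots> \<le> subset_prob p S (\<lambda>a. y \<in> Y a)"
      proof (rule subset_prob_mono)
        fix a assume a: "\<forall>F\<in>\<F>. map (F y) [0..<m] \<in> a"
        have "F y \<in> cyl (map (F y) [0..<m])" for F
          by (simp add: cyl_def)
        then show "y \<in> Y a"
          using a \<open>y \<in> C\<close> unfolding Y_def cyls_def by blast
      qed (use p in auto)
      finally show "p ^ card \<F> \<le> subset_prob p S (\<lambda>a. y \<in> Y a)" .
    qed
  qed (use p assms in auto)
  moreover have "subset_prob p S (\<lambda>a. real (card a) > 2 * p * card S) < q'"
  proof -
    have "subset_prob p S (\<lambda>a. real (card a) > 2 * p * card S) \<le> 1 / (p * card S)"
      using card by (intro subset_prob_card_gt[OF fin _ p(1,2)]) auto
    also have "\<dots> < q'"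
      using m p(1) by (simp add: card field_simps power_one_over)
    finally show ?thesis .
  qed
  \<comment> \<open>If every \<open>a\<close> satisfying the relation were too large, monotonicity
    would contradict the two bounds.\<close>
  ultimately obtain a where a: "a \<subseteq> S" "box_rel r \<eta> \<Gamma> d (Y a)" "real (card a) \<le> 2 * p * card S"
    using subset_prob_mono[of p S "\<lambda>a. box_rel r \<eta> \<Gamma> d (Y a)" "\<lambda>a. real (card a) > 2 * p * card S"] p
    by (smt (verit))
  have fa: "finite a"
    using a(1) fin by (rule finite_subset)
  \<comment> \<open>All words in \<open>a\<close> have length \<open>m\<close>, so each weighs
    \<open>1 / 2 ^ m\<close>.\<close>
  have "(\<Sum>s\<in>a. cover_weight 1 s) = (\<Sum>s\<in>a. 1 / 2 ^ m)"
    using a(1) by (intro sum.cong refl) (auto simp: S_def powr_minus powr_realpow field_simps)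
  also have "\<dots> \<le> \<mu>"
  proof -
    have "real (card a) \<le> \<mu> * 2 ^ m"
      using order_trans[OF a(3)[unfolded card of_nat_power of_nat_numeral] mult_right_mono[OF p(3)]]
      by simp
    then show ?thesis
      by (simp add: field_simps)
  qed
  finally have "a \<in> C_one \<mu>"
    using fa by (simp add: C_one_def cover_family_def)
  then show ?thesis
    using a(2) \<open>\<forall>i. 0 < \<eta> i\<close> unfolding Y_def by blast
qed

end
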